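(* Assume the CFL condition with parameter $\mu_0\in(0,1)$. Let $(G^n)_{n\in\mathbb N}$ be a sequence in $L^2(\Omega)$ and let $(X^n)_{n\in\mathbb N}\subset V_h$, with $X^0=X^{-1}=0$, satisfy $$\frac1{\tau^2}(X^{n+1}-2X^n+X^{n-1},v_h)_\Omega+(\nabla X^n,\nabla v_h)_\Omega=(G^n,v_h)_\Omega\qquad\forall n\ge0,\ \forall v_h\in V_h.$$ For $n\ge-1$ set $X^{n+\frac12}:=\frac12(X^{n+1}+X^n)$, $\dot X^{n+\frac12}:=\frac1\tau(X^{n+1}-X^n)$ and $$E_X^{n+\frac12}:=m_{h\tau}(\dot X^{n+\frac12},\dot X^{n+\frac12})+\|\nabla X^{n+\frac12}\|_\Omega^2 .$$ Let $\rho>0$ be such that $\theta:=\rho\tau\in(0,1]$ and set $C_X(\theta):=\frac{169}{12}(13-6\theta)^{-1}\theta(1-e^{-\theta})^{-1}$. Then $$\sum_{n\in\mathbb N}\tau E_X^{n+\frac12}e^{-2\rho t^n}\le C_X(\theta)\,\mu_0^{-1}\frac1{\rho^2}\sum_{n\in\mathbb N}\tau\|G^n\|_\Omega^2e^{-2\rho t^n}.$$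
   Context: $\Omega\subset\mathbb R^d$, $d\ge1$, is an open bounded Lipschitz polyhedron, $(\cdot,\cdot)_\Omega$, $\|\cdot\|_\Omega$ are the $L^2(\Omega)$ inner product and norm (also for vector-valued functions). $\mathcal T_h$ is an affine simplicial mesh covering $\Omega$ exactly, and $V_h\subset H^1_0(\Omega)$ is the space of continuous, piecewise polynomial functions of degree at most $k\ge1$ on $\mathcal T_h$ vanishing on $\partial\Omega$. $\tau>0$ is a constant time step, $t^n:=n\tau$, $0\in\mathbb N$. $m_{h\tau}(v_h,w_h):=(v_h,w_h)_\Omega-\tau^2(\nabla v_h,\nabla w_h)_\Omega$ on $V_h\times V_h$. The CFL condition is $\tau\le C(\mu_0)h_{\min}$, where $h_{\min}$ is the smallest diameter of a mesh cell, $\mu_0\in(0,1)$ is fixed, and the constant $C(\mu_0)>0$ (depending on $\mu_0$ and the mesh shape-regularity) is such that $\mu_0\|v_h\|_\Omega^2\le m_{h\tau}(v_h,v_h)\le\|v_h\|_\Omega^2$ holds for all $v_h\in V_h$. *)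

theory Defs
  imports "HOL-Analysis.Analysis"
begin

(* Lipschitz boundary: near each boundary point, \<Omega> is the part of a ball lying strictly above
   the graph of a Lipschitz function over the hyperplane orthogonal to some unit vector e. *)

definition lipschitz_boundary :: "'a::euclidean_space set \<Rightarrow> bool" where
  "lipschitz_boundary \<Omega> \<longleftrightarrow>
     (\<forall>x\<in>frontier \<Omega>. \<exists>e r L \<phi>. norm e = 1 \<and> 0 < r \<and> L-lipschitz_on {z. z \<bullet> e = 0} \<phi> \<and>
        \<Omega> \<inter> ball x r = {y \<in> ball x r. \<phi> (y - (y \<bullet> e) *\<^sub>R e) < y \<bullet> e})"

definition lipschitz_polyhedron :: "'a::euclidean_space set \<Rightarrow> bool" where
  "lipschitz_polyhedron \<Omega> \<longleftrightarrow> lipschitz_boundary \<Omega> \<and>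
     (\<exists>\<P>. finite \<P> \<and> (\<forall>P\<in>\<P>. polytope P) \<and> closure \<Omega> = \<Union>\<P>)"

(* Cells are closed full-dimensional simplices. Hanging nodes are allowed; matching meshes
   (the library's triangulation) are the special case where cells meet in common faces. *)

definition simplicial_mesh :: "'a::euclidean_space set \<Rightarrow> 'a set set \<Rightarrow> bool" where
  "simplicial_mesh \<Omega> \<T> \<longleftrightarrow> finite \<T> \<and> (\<forall>K\<in>\<T>. int DIM('a) simplex K) \<and>
     pairwise (\<lambda>K K'. interior K \<inter> interior K' = {}) \<T> \<and> \<Union>\<T> = closure \<Omega>"

definition h_min :: "'a::euclidean_space set set \<Rightarrow> real" where
  "h_min \<T> = Min (diameter ` \<T>)"

(* Polynomial functions of total degree at most k, in the coordinates x \<bullet> b (b \<in> Basis);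
   \<alpha> ranges over the multi-indices with |\<alpha>| \<le> k. *)

definition poly_fun :: "nat \<Rightarrow> ('a::euclidean_space \<Rightarrow> real) \<Rightarrow> bool" where
  "poly_fun k p \<longleftrightarrow> (\<exists>c. \<forall>x. p x =
     (\<Sum>\<alpha> | \<alpha> \<in> (Basis \<rightarrow>\<^sub>E {..k}) \<and> (\<Sum>b\<in>Basis. \<alpha> b) \<le> k. c \<alpha> * (\<Prod>b\<in>Basis. (x \<bullet> b) ^ \<alpha> b)))"

(* Functions on \<Omega> are represented by total functions whose values outside closure \<Omega> are
   irrelevant: integrals are over \<Omega>, and gradients are only integrated over the open set \<Omega>. *)

definition V_h :: "'a::euclidean_space set \<Rightarrow> 'a set set \<Rightarrow> nat \<Rightarrow> ('a \<Rightarrow> real) set" where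
  "V_h \<Omega> \<T> k = {v. continuous_on (closure \<Omega>) v \<and>
     (\<forall>K\<in>\<T>. \<exists>p. poly_fun k p \<and> (\<forall>x\<in>K. v x = p x)) \<and> (\<forall>x\<in>frontier \<Omega>. v x = 0)}"

definition L2_fun :: "'a::euclidean_space set \<Rightarrow> ('a \<Rightarrow> 'b::euclidean_space) set" where
  "L2_fun \<Omega> = {f. set_borel_measurable lebesgue \<Omega> f \<and>
     set_integrable lebesgue \<Omega> (\<lambda>x. (norm (f x))\<^sup>2)}"

definition l2_inner ::
    "'a::euclidean_space set \<Rightarrow> ('a \<Rightarrow> 'b::euclidean_space) \<Rightarrow> ('a \<Rightarrow> 'b) \<Rightarrow> real" where
  "l2_inner \<Omega> f g = (LINT x:\<Omega>|lebesgue. f x \<bullet> g x)"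

definition l2_norm :: "'a::euclidean_space set \<Rightarrow> ('a \<Rightarrow> 'b::euclidean_space) \<Rightarrow> real" where
  "l2_norm \<Omega> f = sqrt (l2_inner \<Omega> f f)"

(* Only applied to elements of V_h, which are smooth in the interior of each cell; the remaining
   points of \<Omega> form a null set. These functions are continuous and piecewise polynomial, so
   this is their weak gradient almost everywhere in \<Omega>. *)

definition grad :: "('a::euclidean_space \<Rightarrow> real) \<Rightarrow> 'a \<Rightarrow> 'a" where
  "grad v x = (SOME D. GDERIV v x :> D)"

definition m_form ::
    "'a::euclidean_space set \<Rightarrow> real \<Rightarrow> ('a \<Rightarrow> real) \<Rightarrow> ('a \<Rightarrow> real) \<Rightarrow> real" where
  "m_form \<Omega> \<tau> v w = l2_inner \<Omega> v w - \<tau>\<^sup>2 * l2_inner \<Omega> (grad v) (grad w)"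

(* C is an admissible value of the constant C(\<mu>) for the given mesh and degree; a constant valid
   for all meshes of a given shape regularity is in particular admissible. *)

definition cfl_constant ::
    "'a::euclidean_space set \<Rightarrow> 'a set set \<Rightarrow> nat \<Rightarrow> real \<Rightarrow> real \<Rightarrow> bool" where
  "cfl_constant \<Omega> \<T> k \<mu> C \<longleftrightarrow> 0 < C \<and>
     (\<forall>\<tau>. 0 < \<tau> \<and> \<tau> \<le> C * h_min \<T> \<longrightarrow>
        (\<forall>v\<in>V_h \<Omega> \<T> k. \<mu> * (l2_norm \<Omega> v)\<^sup>2 \<le> m_form \<Omega> \<tau> v v \<and>
                       m_form \<Omega> \<tau> v v \<le> (l2_norm \<Omega> v)\<^sup>2))"

(* X_half X n, X_dot \<tau> X n and energy \<Omega> \<tau> X n are the quantities at the half step n + 1/2. *)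

definition X_half :: "(int \<Rightarrow> 'a \<Rightarrow> real) \<Rightarrow> int \<Rightarrow> 'a \<Rightarrow> real" where
  "X_half X n = (\<lambda>x. (1/2) * (X (n + 1) x + X n x))"

definition X_dot :: "real \<Rightarrow> (int \<Rightarrow> 'a \<Rightarrow> real) \<Rightarrow> int \<Rightarrow> 'a \<Rightarrow> real" where
  "X_dot \<tau> X n = (\<lambda>x. (1/\<tau>) * (X (n + 1) x - X n x))"

definition energy ::
    "'a::euclidean_space set \<Rightarrow> real \<Rightarrow> (int \<Rightarrow> 'a \<Rightarrow> real) \<Rightarrow> int \<Rightarrow> real" where
  "energy \<Omega> \<tau> X n =
     m_form \<Omega> \<tau> (X_dot \<tau> X n) (X_dot \<tau> X n) + (l2_norm \<Omega> (grad (X_half X n)))\<^sup>2"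

definition C_X :: "real \<Rightarrow> real" where
  "C_X \<theta> = 169 / 12 * inverse (13 - 6 * \<theta>) * \<theta> * inverse (1 - exp (- \<theta>))"

end

theory Submission
  imports Defs
begin

text \<open>
  Two observations carry the proof. The first is that the energy of the theorem is dominated by
  the energy that the scheme really preserves. Write \<open>d = X\<^sup>n\<^sup>+\<^sup>1 - X\<^sup>n\<close>. Testing the scheme at
  step \<open>n\<close> with \<open>X\<^sup>n\<^sup>+\<^sup>1 - X\<^sup>n\<^sup>-\<^sup>1\<close> telescopes exactly in the leapfrog energy
  \<open>\<tau>\<^sup>-\<^sup>2 \<parallel>d\<parallel>\<^sup>2 + (\<nabla> X\<^sup>n, \<nabla> X\<^sup>n\<^sup>+\<^sup>1)\<close>. By polarization this exceeds the energy of the theorem by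
  \<open>3/4 \<parallel>\<nabla> d\<parallel>\<^sup>2\<close>, since the latter energy subtracts \<open>\<parallel>\<nabla> d\<parallel>\<^sup>2\<close> where polarization produces
  \<open>1/4 \<parallel>\<nabla> d\<parallel>\<^sup>2\<close>. The CFL condition bounds \<open>\<parallel>d\<parallel>\<close> by \<open>\<tau> \<mu>\<^sub>0\<^sup>-\<^sup>1\<^sup>/\<^sup>2\<close> times the root of either energy.
  With the Cauchy-Schwarz inequality for the load, the root \<open>s\<close> of the leapfrog energy grows in
  one step by at most \<open>\<tau> \<mu>\<^sub>0\<^sup>-\<^sup>1\<^sup>/\<^sup>2 \<parallel>G\<^sup>n\<parallel>\<close> (\<open>sqrt_leapfrog_energy_step\<close>).

  The second is a discrete Young inequality for an exponential kernel. With \<open>q = exp (- \<rho> \<tau>)\<close>, the weighted roots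
  \<open>u\<^sub>n = q\<^sup>n s\<^sub>n\<^sub>+\<^sub>1\<close> satisfy \<open>u\<^sub>n \<le> q u\<^sub>n\<^sub>-\<^sub>1 + c\<^sub>n\<close> with \<open>c\<^sub>n\<close> the weighted load. Convexity of the
  square gives \<open>u\<^sub>n\<^sup>2 \<le> q u\<^sub>n\<^sub>-\<^sub>1\<^sup>2 + c\<^sub>n\<^sup>2 / (1 - q)\<close>, and summation gives the factor \<open>(1 - q)\<^sup>-\<^sup>2\<close>
  (\<open>weighted_square_sum_le\<close>). What remains is \<open>(\<theta> / (1 - q))\<^sup>2 \<le> C_X \<theta>\<close>, which follows from the
  quadratic Taylor bound of the exponential (\<open>square_le_C_X\<close>).

  For these computations the mass and stiffness forms have to be symmetric and bilinear on
  \<open>V_h\<close>. For the stiffness form this needs an argument, because the gradient of a piecewise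
  polynomial is only determined, and only additive, in the interiors of the cells; their boundaries
  form a null set (\<open>grad_lincomb_AE\<close>, \<open>grad_V_h_in_L2\<close>).
\<close>

section \<open>Square-integrable functions\<close>

lemma L2_fun_inner_integrable:
  fixes f g :: "'a::euclidean_space \<Rightarrow> 'b::euclidean_space"
  assumes f: "f \<in> L2_fun \<Omega>" and g: "g \<in> L2_fun \<Omega>"
  shows "set_integrable lebesgue \<Omega> (\<lambda>x. f x \<bullet> g x)"
proof (rule set_integrable_bound)
  show "set_integrable lebesgue \<Omega> (\<lambda>x. (norm (f x))\<^sup>2 + (norm (g x))\<^sup>2)"
    using f g by (auto simp: L2_fun_def)
  have [measurable]: "(\<lambda>x. indicator \<Omega> x *\<^sub>R f x) \<in> borel_measurable lebesgue"
    "(\<lambda>x. indicator \<Omega> x *\<^sub>R g x) \<in> borel_measurable lebesgue"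
    using f g by (auto simp: L2_fun_def set_borel_measurable_def)
  have "(\<lambda>x. (indicator \<Omega> x *\<^sub>R f x) \<bullet> (indicator \<Omega> x *\<^sub>R g x)) \<in> borel_measurable lebesgue"
    by measurable
  also have "(\<lambda>x. (indicator \<Omega> x *\<^sub>R f x) \<bullet> (indicator \<Omega> x *\<^sub>R g x)) =
      (\<lambda>x. indicator \<Omega> x *\<^sub>R (f x \<bullet> g x))"
    by (auto simp: indicator_def)
  finally show "set_borel_measurable lebesgue \<Omega> (\<lambda>x. f x \<bullet> g x)"
    by (simp add: set_borel_measurable_def)
  have "norm (a \<bullet> b) \<le> norm ((norm a)\<^sup>2 + (norm b)\<^sup>2)" for a b :: 'b
  proof -
    have "\<bar>a \<bullet> b\<bar> \<le> norm a * norm b"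
      by (rule Cauchy_Schwarz_ineq2)
    moreover have "2 * (norm a * norm b) \<le> (norm a)\<^sup>2 + (norm b)\<^sup>2"
      using sum_squares_bound[of "norm a" "norm b"] by simp
    moreover have "0 \<le> norm a * norm b"
      by simp
    ultimately show ?thesis
      by simp
  qed
  then show "AE x in lebesgue. x \<in> \<Omega> \<longrightarrow>
      norm (f x \<bullet> g x) \<le> norm ((norm (f x))\<^sup>2 + (norm (g x))\<^sup>2)"
    by auto
qed

lemma L2_fun_lincomb:
  fixes f g :: "'a::euclidean_space \<Rightarrow> 'b::euclidean_space"
  assumes f: "f \<in> L2_fun \<Omega>" and g: "g \<in> L2_fun \<Omega>"
  shows "(\<lambda>x. a *\<^sub>R f x + b *\<^sub>R g x) \<in> L2_fun \<Omega>"
proof -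
  have [measurable]: "(\<lambda>x. indicator \<Omega> x *\<^sub>R f x) \<in> borel_measurable lebesgue"
    "(\<lambda>x. indicator \<Omega> x *\<^sub>R g x) \<in> borel_measurable lebesgue"
    using f g by (auto simp: L2_fun_def set_borel_measurable_def)
  have "(\<lambda>x. a *\<^sub>R (indicator \<Omega> x *\<^sub>R f x) + b *\<^sub>R (indicator \<Omega> x *\<^sub>R g x))
      \<in> borel_measurable lebesgue"
    by measurable
  also have "(\<lambda>x. a *\<^sub>R (indicator \<Omega> x *\<^sub>R f x) + b *\<^sub>R (indicator \<Omega> x *\<^sub>R g x)) =
      (\<lambda>x. indicator \<Omega> x *\<^sub>R (a *\<^sub>R f x + b *\<^sub>R g x))"
    by (auto simp: indicator_def)
  finally have meas: "set_borel_measurable lebesgue \<Omega> (\<lambda>x. a *\<^sub>R f x + b *\<^sub>R g x)"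
    by (simp add: set_borel_measurable_def)
  have int: "set_integrable lebesgue \<Omega> (\<lambda>x. c * (u x \<bullet> v x))"
    if "u \<in> L2_fun \<Omega>" "v \<in> L2_fun \<Omega>" for c :: real and u v :: "'a \<Rightarrow> 'b"
    using L2_fun_inner_integrable[OF that] by (rule set_integrable_mult_right)
  have "set_integrable lebesgue \<Omega>
      (\<lambda>x. a\<^sup>2 * (f x \<bullet> f x) + (2 * a * b) * (f x \<bullet> g x) + b\<^sup>2 * (g x \<bullet> g x))"
    by (intro set_integral_add(1) int f g)
  also have "(\<lambda>x. a\<^sup>2 * (f x \<bullet> f x) + (2 * a * b) * (f x \<bullet> g x) + b\<^sup>2 * (g x \<bullet> g x)) =
      (\<lambda>x. (norm (a *\<^sub>R f x + b *\<^sub>R g x))\<^sup>2)"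
    unfolding power2_norm_eq_inner
    by (auto simp: power2_eq_square inner_commute algebra_simps)
  finally have "set_integrable lebesgue \<Omega> (\<lambda>x. (norm (a *\<^sub>R f x + b *\<^sub>R g x))\<^sup>2)" .
  with meas show ?thesis
    by (simp add: L2_fun_def)
qed

lemma l2_inner_commute: "l2_inner \<Omega> f g = l2_inner \<Omega> g f"
  by (simp add: l2_inner_def inner_commute)

lemma l2_inner_lincomb_right:
  fixes f g h :: "'a::euclidean_space \<Rightarrow> 'b::euclidean_space"
  assumes "f \<in> L2_fun \<Omega>" "g \<in> L2_fun \<Omega>" "h \<in> L2_fun \<Omega>"
  shows "l2_inner \<Omega> f (\<lambda>x. a *\<^sub>R g x + b *\<^sub>R h x) = a * l2_inner \<Omega> f g + b * l2_inner \<Omega> f h"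
proof -
  have "set_integrable lebesgue \<Omega> (\<lambda>x. a * (f x \<bullet> g x))"
    "set_integrable lebesgue \<Omega> (\<lambda>x. b * (f x \<bullet> h x))"
    by (intro set_integrable_mult_right L2_fun_inner_integrable assms)+
  then show ?thesis
    by (simp add: l2_inner_def inner_add_right)
qed

lemma l2_inner_cong_AE:
  fixes f g h :: "'a::euclidean_space \<Rightarrow> 'b::euclidean_space"
  assumes "f \<in> L2_fun \<Omega>" "g \<in> L2_fun \<Omega>" "h \<in> L2_fun \<Omega>"
    and "AE x in lebesgue. x \<in> \<Omega> \<longrightarrow> g x = h x"
  shows "l2_inner \<Omega> f g = l2_inner \<Omega> f h"
  unfolding l2_inner_def set_lebesgue_integral_def
proof (rule integral_cong_AE)
  show "(\<lambda>x. indicator \<Omega> x *\<^sub>R (f x \<bullet> g x)) \<in> borel_measurable lebesgue"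
    "(\<lambda>x. indicator \<Omega> x *\<^sub>R (f x \<bullet> h x)) \<in> borel_measurable lebesgue"
    using L2_fun_inner_integrable[OF assms(1,2)] L2_fun_inner_integrable[OF assms(1,3)]
    by (auto simp: set_integrable_def dest: borel_measurable_integrable)
  show "AE x in lebesgue. indicator \<Omega> x *\<^sub>R (f x \<bullet> g x) = indicator \<Omega> x *\<^sub>R (f x \<bullet> h x)"
    using assms(4) by (auto simp: indicator_def elim: eventually_mono)
qed

lemma l2_inner_self_nonneg: "0 \<le> l2_inner \<Omega> f f"
  by (auto simp: l2_inner_def set_lebesgue_integral_def intro!: integral_nonneg)

lemma l2_norm_power2: "(l2_norm \<Omega> f)\<^sup>2 = l2_inner \<Omega> f f"
  by (simp add: l2_norm_def l2_inner_self_nonneg)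

lemma l2_norm_nonneg: "0 \<le> l2_norm \<Omega> f"
  by (simp add: l2_norm_def l2_inner_self_nonneg)

text \<open>The function space is not a type with an inner product (the form is only semidefinite, and
  additive only on square-integrable functions), so the classical argument is repeated: the quadratic
  form spanned by \<open>f\<close> and \<open>g\<close> is nonnegative, which bounds its discriminant.\<close>
lemma l2_Cauchy_Schwarz:
  fixes f g :: "'a::euclidean_space \<Rightarrow> 'b::euclidean_space"
  assumes f: "f \<in> L2_fun \<Omega>" and g: "g \<in> L2_fun \<Omega>"
  shows "l2_inner \<Omega> f g \<le> l2_norm \<Omega> f * l2_norm \<Omega> g"
proof -
  define p q r where "p = l2_inner \<Omega> f f" and "q = l2_inner \<Omega> g g" and "r = l2_inner \<Omega> f g"
  have quad: "0 \<le> a\<^sup>2 * p + 2 * a * b * r + b\<^sup>2 * q" for a b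
  proof -
    let ?w = "\<lambda>x. a *\<^sub>R f x + b *\<^sub>R g x"
    have w: "?w \<in> L2_fun \<Omega>"
      by (rule L2_fun_lincomb[OF f g])
    have "0 \<le> l2_inner \<Omega> ?w ?w"
      by (rule l2_inner_self_nonneg)
    also have "\<dots> = a * l2_inner \<Omega> f ?w + b * l2_inner \<Omega> g ?w"
      by (simp add: l2_inner_lincomb_right[OF w f g] l2_inner_commute[of \<Omega> ?w])
    also have "\<dots> = a\<^sup>2 * p + 2 * a * b * r + b\<^sup>2 * q"
      by (simp add: l2_inner_lincomb_right f g p_def q_def r_def l2_inner_commute[of \<Omega> g f]
          power2_eq_square algebra_simps)
    finally show ?thesis .
  qed
  have "0 \<le> p" "0 \<le> q"
    by (simp_all add: p_def q_def l2_inner_self_nonneg)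
  have "r\<^sup>2 \<le> p * q"
  proof (cases "q = 0")
    case True
    \<comment> \<open>The quadratic form is then affine in its second coefficient, hence constant.\<close>
    have "r = 0"
    proof (rule ccontr)
      assume "r \<noteq> 0"
      then show False
        using quad[of 1 "- (p + 1) / r"] True \<open>0 \<le> p\<close> by simp
    qed
    then show ?thesis
      using \<open>0 \<le> p\<close> True by simp
  next
    case False
    \<comment> \<open>The coefficients of the minimizer, cleared of denominators.\<close>
    have "0 \<le> q\<^sup>2 * p + 2 * q * (- r) * r + (- r)\<^sup>2 * q"
      by (rule quad)
    also have "\<dots> = q * (p * q - r\<^sup>2)"
      by (simp add: power2_eq_square algebra_simps)
    finally show ?thesis
      using False \<open>0 \<le> q\<close> by (simp add: zero_le_mult_iff)
  qed
  then have "\<bar>r\<bar> \<le> sqrt (p * q)"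
    by (rule real_le_rsqrt[of "\<bar>r\<bar>", simplified])
  then show ?thesis
    by (simp add: l2_norm_def p_def q_def r_def real_sqrt_mult)
qed

lemma bounded_measurable_imp_L2_fun:
  fixes f :: "'a::euclidean_space \<Rightarrow> 'b::euclidean_space"
  assumes \<Omega>: "open \<Omega>" "bounded \<Omega>"
    and f: "set_borel_measurable lebesgue \<Omega> f"
    and B: "AE x in lebesgue. x \<in> \<Omega> \<longrightarrow> norm (f x) \<le> B"
  shows "f \<in> L2_fun \<Omega>"
proof -
  have meas: "(\<lambda>x. indicator \<Omega> x *\<^sub>R f x) \<in> borel_measurable lebesgue"
    using f by (simp add: set_borel_measurable_def)
  have "integrable lebesgue (\<lambda>x. (norm (indicator \<Omega> x *\<^sub>R f x))\<^sup>2)"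
  proof (rule integrableI_bounded_set)
    show "\<Omega> \<in> sets lebesgue"
      using \<Omega> by simp
    show "emeasure lebesgue \<Omega> < \<infinity>"
      using lmeasurable_open[OF \<Omega>(2,1)] by (auto simp: fmeasurable_def simp del: emeasure_completion)
    show "(\<lambda>x. (norm (indicator \<Omega> x *\<^sub>R f x))\<^sup>2) \<in> borel_measurable lebesgue"
      using meas by measurable
    show "AE x in lebesgue. x \<in> \<Omega> \<longrightarrow> norm ((norm (indicator \<Omega> x *\<^sub>R f x))\<^sup>2) \<le> B\<^sup>2"
      using B by eventually_elim (auto intro: power_mono)
    show "AE x in lebesgue. x \<notin> \<Omega> \<longrightarrow> (norm (indicator \<Omega> x *\<^sub>R f x))\<^sup>2 = 0"
      by simp
  qed
  also have "(\<lambda>x. (norm (indicator \<Omega> x *\<^sub>R f x))\<^sup>2) = (\<lambda>x. indicator \<Omega> x *\<^sub>R (norm (f x))\<^sup>2)"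
    by (auto simp: indicator_def)
  finally show ?thesis
    using f by (simp add: L2_fun_def set_integrable_def)
qed

section \<open>Gradients of piecewise polynomials\<close>

lemma grad_eq:
  assumes "GDERIV v x :> D"
  shows "grad v x = D"
proof -
  have "GDERIV v x :> grad v x"
    unfolding grad_def using assms by (rule someI)
  then have "(\<lambda>h. h \<bullet> grad v x) = (\<lambda>h. h \<bullet> D)"
    using assms unfolding gderiv_def by (rule has_derivative_unique)
  then show ?thesis
    by (metis inner_commute vector_eq_ldot)
qed

definition has_continuous_gradient :: "('a::real_inner \<Rightarrow> real) \<Rightarrow> bool" where
  "has_continuous_gradient p \<longleftrightarrow> (\<exists>D. continuous_on UNIV D \<and> (\<forall>x. GDERIV p x :> D x))"

lemma has_continuous_gradient_const: "has_continuous_gradient (\<lambda>x. c)"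
  unfolding has_continuous_gradient_def
  by (intro exI[of _ "\<lambda>x. 0"]) (auto intro: GDERIV_const)

lemma has_continuous_gradient_inner: "has_continuous_gradient (\<lambda>x. x \<bullet> b)"
  unfolding has_continuous_gradient_def gderiv_def
  by (intro exI[of _ "\<lambda>x. b"]) (auto intro!: derivative_eq_intros)

lemma has_continuous_gradient_add:
  assumes "has_continuous_gradient p" "has_continuous_gradient q"
  shows "has_continuous_gradient (\<lambda>x. p x + q x)"
proof -
  obtain D E where "continuous_on UNIV D" "\<And>x. GDERIV p x :> D x"
    "continuous_on UNIV E" "\<And>x. GDERIV q x :> E x"
    using assms unfolding has_continuous_gradient_def by blast
  then show ?thesis
    unfolding has_continuous_gradient_def
    by (intro exI[of _ "\<lambda>x. D x + E x"]) (auto intro!: GDERIV_add continuous_intros)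
qed

lemma has_continuous_gradient_mult:
  assumes "has_continuous_gradient p" "has_continuous_gradient q"
  shows "has_continuous_gradient (\<lambda>x. p x * q x)"
proof -
  obtain D E where D: "continuous_on UNIV D" "\<And>x. GDERIV p x :> D x"
    and E: "continuous_on UNIV E" "\<And>x. GDERIV q x :> E x"
    using assms unfolding has_continuous_gradient_def by blast
  have "isCont p x" "isCont q x" for x
    using D(2)[of x] E(2)[of x] unfolding gderiv_def by (auto intro: has_derivative_continuous)
  then have "continuous_on UNIV p" "continuous_on UNIV q"
    by (simp_all add: continuous_at_imp_continuous_on)
  with D E show ?thesis
    unfolding has_continuous_gradient_def
    by (intro exI[of _ "\<lambda>x. p x *\<^sub>R E x + q x *\<^sub>R D x"]) (auto intro!: GDERIV_mult continuous_intros)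
qed

lemma has_continuous_gradient_sum:
  assumes "\<And>i. i \<in> I \<Longrightarrow> has_continuous_gradient (p i)"
  shows "has_continuous_gradient (\<lambda>x. \<Sum>i\<in>I. p i x)"
  using assms
  by (induction I rule: infinite_finite_induct)
     (auto intro: has_continuous_gradient_const has_continuous_gradient_add)

lemma has_continuous_gradient_prod:
  assumes "\<And>i. i \<in> I \<Longrightarrow> has_continuous_gradient (p i)"
  shows "has_continuous_gradient (\<lambda>x. \<Prod>i\<in>I. p i x)"
  using assms
  by (induction I rule: infinite_finite_induct)
     (auto intro: has_continuous_gradient_const has_continuous_gradient_mult)

lemma has_continuous_gradient_power:
  assumes "has_continuous_gradient p"
  shows "has_continuous_gradient (\<lambda>x. p x ^ n)"
  by (induction n)
     (auto intro: has_continuous_gradient_const has_continuous_gradient_mult assms)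

lemma poly_fun_has_continuous_gradient:
  assumes "poly_fun k p"
  shows "has_continuous_gradient p"
proof -
  obtain c where c: "\<forall>x. p x = (\<Sum>\<alpha> | \<alpha> \<in> (Basis \<rightarrow>\<^sub>E {..k}) \<and> (\<Sum>b\<in>Basis. \<alpha> b) \<le> k.
      c \<alpha> * (\<Prod>b\<in>Basis. (x \<bullet> b) ^ \<alpha> b))"
    using assms unfolding poly_fun_def ..
  show ?thesis
    unfolding ext[OF c[rule_format]]
    by (intro has_continuous_gradient_sum has_continuous_gradient_prod
        has_continuous_gradient_mult has_continuous_gradient_const
        has_continuous_gradient_power has_continuous_gradient_inner)
qed

lemma poly_fun_lincomb:
  assumes "poly_fun k p" "poly_fun k q"
  shows "poly_fun k (\<lambda>x. a * p x + b * q x)"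
proof -
  obtain c where c: "\<forall>x. p x = (\<Sum>\<alpha> | \<alpha> \<in> (Basis \<rightarrow>\<^sub>E {..k}) \<and> (\<Sum>b\<in>Basis. \<alpha> b) \<le> k.
      c \<alpha> * (\<Prod>b\<in>Basis. (x \<bullet> b) ^ \<alpha> b))"
    using assms(1) unfolding poly_fun_def ..
  obtain d where d: "\<forall>x. q x = (\<Sum>\<alpha> | \<alpha> \<in> (Basis \<rightarrow>\<^sub>E {..k}) \<and> (\<Sum>b\<in>Basis. \<alpha> b) \<le> k.
      d \<alpha> * (\<Prod>b\<in>Basis. (x \<bullet> b) ^ \<alpha> b))"
    using assms(2) unfolding poly_fun_def ..
  show ?thesis
    unfolding poly_fun_def
  proof (intro exI allI)
    fix x
    show "a * p x + b * q x = (\<Sum>\<alpha> | \<alpha> \<in> (Basis \<rightarrow>\<^sub>E {..k}) \<and> (\<Sum>b\<in>Basis. \<alpha> b) \<le> k.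
        (a * c \<alpha> + b * d \<alpha>) * (\<Prod>b\<in>Basis. (x \<bullet> b) ^ \<alpha> b))"
      unfolding c[rule_format] d[rule_format] distrib_right mult.assoc sum.distrib sum_distrib_left ..
  qed
qed

lemma V_h_lincomb:
  assumes v: "v \<in> V_h \<Omega> \<T> k" and w: "w \<in> V_h \<Omega> \<T> k"
  shows "(\<lambda>x. a * v x + b * w x) \<in> V_h \<Omega> \<T> k"
proof -
  have "\<exists>p. poly_fun k p \<and> (\<forall>x\<in>K. a * v x + b * w x = p x)" if K: "K \<in> \<T>" for K
  proof -
    have "\<exists>p. poly_fun k p \<and> (\<forall>x\<in>K. v x = p x)" "\<exists>q. poly_fun k q \<and> (\<forall>x\<in>K. w x = q x)"
      using v w K by (simp_all add: V_h_def)
    then obtain p q where "poly_fun k p" "\<forall>x\<in>K. v x = p x" "poly_fun k q" "\<forall>x\<in>K. w x = q x"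
      by (elim exE conjE)
    then show ?thesis
      by (intro exI[of _ "\<lambda>x. a * p x + b * q x"] conjI poly_fun_lincomb) simp_all
  qed
  moreover have "continuous_on (closure \<Omega>) (\<lambda>x. a * v x + b * w x)"
    using v w unfolding V_h_def by (intro continuous_intros) simp_all
  ultimately show ?thesis
    using v w by (simp add: V_h_def)
qed

lemma zero_in_V_h: "(\<lambda>x. 0) \<in> V_h \<Omega> \<T> k"
proof -
  have "poly_fun k (\<lambda>x. 0)"
    unfolding poly_fun_def by (intro exI[of _ "\<lambda>\<alpha>. 0"]) simp
  then show ?thesis
    unfolding V_h_def by (auto intro!: exI[of _ "\<lambda>x. 0"])
qed

text \<open>The gradient field of the cell polynomial serves as a continuous extension of the gradient
  beyond the cell. Measurability and boundedness of the gradient are read off from it.\<close>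
lemma V_h_gradient_on_cell:
  assumes "v \<in> V_h \<Omega> \<T> k" "K \<in> \<T>"
  obtains D where "continuous_on UNIV D" "\<And>x. x \<in> interior K \<Longrightarrow> GDERIV v x :> D x"
proof -
  obtain p where p: "poly_fun k p" "\<And>x. x \<in> K \<Longrightarrow> v x = p x"
    using assms unfolding V_h_def by blast
  obtain D where D: "continuous_on UNIV D" "\<And>x. GDERIV p x :> D x"
    using poly_fun_has_continuous_gradient[OF p(1)] unfolding has_continuous_gradient_def by blast
  have "GDERIV v x :> D x" if "x \<in> interior K" for x
    using D(2)[of x] unfolding gderiv_def
    by (rule has_derivative_transform_within_open[OF _ open_interior that])
       (use p(2) interior_subset in fastforce)
  with D(1) show thesis
    by (rule that)
qed

text \<open>Cells are convex, so their boundaries are null sets, and there are finitely many of them.\<close>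
lemma AE_in_cell_interior:
  assumes "simplicial_mesh \<Omega> \<T>"
  shows "AE x in lebesgue. x \<in> \<Omega> \<longrightarrow> (\<exists>K\<in>\<T>. x \<in> interior K)"
proof -
  have "negligible (\<Union>K\<in>\<T>. frontier K)"
    using assms unfolding simplicial_mesh_def
    by (intro negligible_Union) (auto intro: negligible_convex_frontier convex_simplex)
  then have "(\<Union>K\<in>\<T>. frontier K) \<in> null_sets lebesgue"
    by (simp add: negligible_iff_null_sets)
  then have "AE x in lebesgue. x \<notin> (\<Union>K\<in>\<T>. frontier K)"
    by (rule AE_not_in)
  then show ?thesis
  proof eventually_elim
    case (elim x)
    show ?case
    proof
      assume "x \<in> \<Omega>"
      then obtain K where K: "K \<in> \<T>" "x \<in> K"
        using assms closure_subset unfolding simplicial_mesh_def by blast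
      then show "\<exists>K\<in>\<T>. x \<in> interior K"
        using elim closure_subset unfolding frontier_def by blast
    qed
  qed
qed

text \<open>On the mesh skeleton \<open>v\<close> and \<open>w\<close> may fail to be differentiable, where \<open>grad\<close> is an arbitrary
  choice without any linearity.\<close>
lemma grad_lincomb_AE:
  assumes mesh: "simplicial_mesh \<Omega> \<T>" and v: "v \<in> V_h \<Omega> \<T> k" and w: "w \<in> V_h \<Omega> \<T> k"
  shows "AE x in lebesgue. x \<in> \<Omega> \<longrightarrow>
    grad (\<lambda>x. a * v x + b * w x) x = a *\<^sub>R grad v x + b *\<^sub>R grad w x"
  using AE_in_cell_interior[OF mesh]
proof eventually_elim
  case (elim x)
  show ?case
  proof
    assume "x \<in> \<Omega>"
    then obtain K where K: "K \<in> \<T>" "x \<in> interior K"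
      using elim by blast
    obtain D E where "GDERIV v x :> D" "GDERIV w x :> E"
      using V_h_gradient_on_cell[OF v K(1)] V_h_gradient_on_cell[OF w K(1)] K(2) by metis
    moreover have "GDERIV (\<lambda>x. a * v x + b * w x) x :> a *\<^sub>R D + b *\<^sub>R E"
      using GDERIV_add[OF GDERIV_mult[OF GDERIV_const[of a] \<open>GDERIV v x :> D\<close>]
          GDERIV_mult[OF GDERIV_const[of b] \<open>GDERIV w x :> E\<close>]]
      by simp
    ultimately show "grad (\<lambda>x. a * v x + b * w x) x = a *\<^sub>R grad v x + b *\<^sub>R grad w x"
      by (simp add: grad_eq)
  qed
qed

lemma V_h_subset_L2:
  assumes \<Omega>: "open \<Omega>" "bounded \<Omega>" and v: "v \<in> V_h \<Omega> \<T> k"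
  shows "v \<in> L2_fun \<Omega>"
proof -
  have cont: "continuous_on (closure \<Omega>) v"
    using v by (simp add: V_h_def)
  have "compact (closure \<Omega>)"
    using \<Omega> by simp
  then have "bounded (v ` closure \<Omega>)"
    using cont by (intro compact_imp_bounded compact_continuous_image)
  then obtain B where B: "\<And>x. x \<in> closure \<Omega> \<Longrightarrow> norm (v x) \<le> B"
    by (auto simp: bounded_iff)
  have "(\<lambda>x. indicator \<Omega> x *\<^sub>R v x) \<in> borel_measurable borel"
    using \<Omega> continuous_on_subset[OF cont closure_subset]
    by (intro borel_measurable_continuous_on_indicator) auto
  then have "set_borel_measurable lebesgue \<Omega> v"
    unfolding set_borel_measurable_def by (intro measurable_completion) simp
  then show ?thesis
    using \<Omega> B closure_subset by (intro bounded_measurable_imp_L2_fun[where B = B]) auto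
qed

lemma grad_V_h_in_L2:
  fixes v :: "'a::euclidean_space \<Rightarrow> real"
  assumes \<Omega>: "open \<Omega>" "bounded \<Omega>" and mesh: "simplicial_mesh \<Omega> \<T>" and v: "v \<in> V_h \<Omega> \<T> k"
  shows "grad v \<in> L2_fun \<Omega>"
proof -
  have T: "finite \<T>" "\<And>K. K \<in> \<T> \<Longrightarrow> compact K"
    "\<And>K L. K \<in> \<T> \<Longrightarrow> L \<in> \<T> \<Longrightarrow> K \<noteq> L \<Longrightarrow> interior K \<inter> interior L = {}"
    using mesh by (auto simp: simplicial_mesh_def pairwise_def intro: compact_simplex)
  have "\<exists>D. continuous_on UNIV D \<and> (\<forall>x\<in>interior K. grad v x = D x)" if "K \<in> \<T>" for K
    using V_h_gradient_on_cell[OF v that] grad_eq by metis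
  then obtain D where D: "\<And>K. K \<in> \<T> \<Longrightarrow> continuous_on UNIV (D K)"
    "\<And>K x. K \<in> \<T> \<Longrightarrow> x \<in> interior K \<Longrightarrow> grad v x = D K x"
    by metis
  \<comment> \<open>A Borel representative of the gradient: the cell interiors are disjoint, so at most one
    summand is nonzero.\<close>
  define g where "g x = (\<Sum>K\<in>\<T>. indicator (interior K) x *\<^sub>R D K x)" for x
  have g: "g x = grad v x" if "K \<in> \<T>" "x \<in> interior K" for K x
  proof -
    have "x \<notin> interior L" if "L \<in> \<T>" "L \<noteq> K" for L
      using T(3)[of K L] \<open>K \<in> \<T>\<close> \<open>x \<in> interior K\<close> that by blast
    then have "g x = (\<Sum>L\<in>\<T>. if L = K then D K x else 0)"
      unfolding g_def using that by (intro sum.cong) auto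
    also have "\<dots> = D K x"
      using T(1) \<open>K \<in> \<T>\<close> by simp
    finally show ?thesis
      using D(2) that by simp
  qed
  have "\<exists>B. \<forall>x\<in>K. norm (D K x) \<le> B" if "K \<in> \<T>" for K
  proof -
    have "bounded (D K ` K)"
      using T(2) D(1) that
      by (intro compact_imp_bounded compact_continuous_image continuous_on_subset[of UNIV "D K" K])
         auto
    then show ?thesis
      by (auto simp: bounded_iff)
  qed
  then obtain B where B: "\<And>K x. K \<in> \<T> \<Longrightarrow> x \<in> K \<Longrightarrow> norm (D K x) \<le> B K"
    by metis
  have bnd: "norm (grad v x) \<le> (\<Sum>K\<in>\<T>. \<bar>B K\<bar>)" if "K \<in> \<T>" "x \<in> interior K" for K x
  proof -
    have "norm (grad v x) \<le> B K"
      using B D that interior_subset by (metis subsetD)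
    also have "\<dots> \<le> \<bar>B K\<bar>"
      by simp
    also have "\<dots> \<le> (\<Sum>K\<in>\<T>. \<bar>B K\<bar>)"
      using T(1) that by (intro member_le_sum) auto
    finally show ?thesis .
  qed
  have [measurable]: "D K \<in> borel_measurable borel" if "K \<in> \<T>" for K
    using D(1)[OF that] by (rule borel_measurable_continuous_onI)
  have "g \<in> borel_measurable borel"
    unfolding g_def
    by (intro borel_measurable_sum borel_measurable_scaleR borel_measurable_indicator) auto
  moreover have "\<Omega> \<in> sets borel"
    using \<Omega> by simp
  ultimately have "(\<lambda>x. indicator \<Omega> x *\<^sub>R g x) \<in> borel_measurable borel"
    by measurable
  then have "(\<lambda>x. indicator \<Omega> x *\<^sub>R g x) \<in> borel_measurable lebesgue"
    by (intro measurable_completion) simp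
  moreover have "AE x in lebesgue. indicator \<Omega> x *\<^sub>R g x = indicator \<Omega> x *\<^sub>R grad v x"
    using AE_in_cell_interior[OF mesh] by eventually_elim (auto simp: g indicator_def)
  ultimately have "set_borel_measurable lebesgue \<Omega> (grad v)"
    unfolding set_borel_measurable_def by (rule borel_measurable_AE)
  moreover have "AE x in lebesgue. x \<in> \<Omega> \<longrightarrow> norm (grad v x) \<le> (\<Sum>K\<in>\<T>. \<bar>B K\<bar>)"
    using AE_in_cell_interior[OF mesh] by eventually_elim (use bnd in blast)
  ultimately show ?thesis
    by (rule bounded_measurable_imp_L2_fun[OF \<Omega>])
qed

section \<open>The leapfrog energy\<close>

text \<open>The energy argument uses only the algebra of the mass form and the stiffness form. Linearity
  is demanded on \<open>V\<close> alone, since neither integral is additive on arbitrary functions.\<close>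
locale symmetric_form_on =
  fixes V :: "('a \<Rightarrow> real) set" and B :: "('a \<Rightarrow> real) \<Rightarrow> ('a \<Rightarrow> real) \<Rightarrow> real"
  assumes lincomb_closed: "\<And>a b v w. v \<in> V \<Longrightarrow> w \<in> V \<Longrightarrow> (\<lambda>x. a * v x + b * w x) \<in> V"
    and commute: "\<And>v w. B v w = B w v"
    and lincomb_right: "\<And>a b u v w. u \<in> V \<Longrightarrow> v \<in> V \<Longrightarrow> w \<in> V \<Longrightarrow>
      B u (\<lambda>x. a * v x + b * w x) = a * B u v + b * B u w"
begin

lemma add_closed: "v \<in> V \<Longrightarrow> w \<in> V \<Longrightarrow> (\<lambda>x. v x + w x) \<in> V"
  using lincomb_closed[of v w 1 1] by simp

lemma diff_closed: "v \<in> V \<Longrightarrow> w \<in> V \<Longrightarrow> (\<lambda>x. v x - w x) \<in> V"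
  using lincomb_closed[of v w 1 "-1"] by simp

lemma scale_closed: "v \<in> V \<Longrightarrow> (\<lambda>x. c * v x) \<in> V"
  using lincomb_closed[of v v c 0] by simp

lemma add_right: "u \<in> V \<Longrightarrow> v \<in> V \<Longrightarrow> w \<in> V \<Longrightarrow> B u (\<lambda>x. v x + w x) = B u v + B u w"
  using lincomb_right[of u v w 1 1] by simp

lemma diff_right: "u \<in> V \<Longrightarrow> v \<in> V \<Longrightarrow> w \<in> V \<Longrightarrow> B u (\<lambda>x. v x - w x) = B u v - B u w"
  using lincomb_right[of u v w 1 "-1"] by simp

lemma add_left: "u \<in> V \<Longrightarrow> v \<in> V \<Longrightarrow> w \<in> V \<Longrightarrow> B (\<lambda>x. v x + w x) u = B v u + B w u"
  by (simp add: add_right commute[of _ u])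

lemma diff_left: "u \<in> V \<Longrightarrow> v \<in> V \<Longrightarrow> w \<in> V \<Longrightarrow> B (\<lambda>x. v x - w x) u = B v u - B w u"
  by (simp add: diff_right commute[of _ u])

lemma scale_self:
  assumes "v \<in> V"
  shows "B (\<lambda>x. c * v x) (\<lambda>x. c * v x) = c\<^sup>2 * B v v"
proof -
  have right: "B u (\<lambda>x. c * v x) = c * B u v" if "u \<in> V" for u
    using lincomb_right[of u v v c 0] assms that by simp
  have "B (\<lambda>x. c * v x) (\<lambda>x. c * v x) = c * B (\<lambda>x. c * v x) v"
    by (rule right[OF scale_closed[OF assms]])
  also have "B (\<lambda>x. c * v x) v = c * B v v"
    using right[OF assms] commute by metis
  finally show ?thesis
    by (simp add: power2_eq_square)
qed

end

text \<open>\<open>B\<close> and \<open>A\<close> stand for \<open>(v, w)\<close> and \<open>(\<nabla> v, \<nabla> w)\<close>; coercivity is the lower CFL bound.\<close>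
locale wave_forms = mass: symmetric_form_on V B + stiffness: symmetric_form_on V A
  for V :: "('a \<Rightarrow> real) set" and B A +
  fixes \<tau> \<mu> :: real
  assumes tau_pos: "0 < \<tau>" and mu_pos: "0 < \<mu>"
    and mass_nonneg: "\<And>v. v \<in> V \<Longrightarrow> 0 \<le> B v v"
    and stiffness_nonneg: "\<And>v. v \<in> V \<Longrightarrow> 0 \<le> A v v"
    and coercive: "\<And>v. v \<in> V \<Longrightarrow> \<mu> * B v v \<le> B v v - \<tau>\<^sup>2 * A v v"
begin

definition leapfrog_energy :: "('a \<Rightarrow> real) \<Rightarrow> ('a \<Rightarrow> real) \<Rightarrow> real" where
  "leapfrog_energy v w = B (\<lambda>x. w x - v x) (\<lambda>x. w x - v x) / \<tau>\<^sup>2 + A v w"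

text \<open>The energy of the theorem, at the half step between two consecutive iterates \<open>v\<close> and \<open>w\<close>: the
  factors \<open>1 / \<tau>\<^sup>2\<close> and \<open>1 / 4\<close> come from the difference quotient and from the average.\<close>
definition modified_energy :: "('a \<Rightarrow> real) \<Rightarrow> ('a \<Rightarrow> real) \<Rightarrow> real" where
  "modified_energy v w =
     (B (\<lambda>x. w x - v x) (\<lambda>x. w x - v x) - \<tau>\<^sup>2 * A (\<lambda>x. w x - v x) (\<lambda>x. w x - v x)) / \<tau>\<^sup>2
       + A (\<lambda>x. w x + v x) (\<lambda>x. w x + v x) / 4"

text \<open>Polarization of \<open>A v w\<close> into the sum and the difference of \<open>v\<close> and \<open>w\<close>.\<close>
lemma leapfrog_energy_eq_modified_energy:
  assumes "v \<in> V" "w \<in> V"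
  shows "leapfrog_energy v w =
    modified_energy v w + 3 / 4 * A (\<lambda>x. w x - v x) (\<lambda>x. w x - v x)"
proof -
  have "A v w = (A (\<lambda>x. w x + v x) (\<lambda>x. w x + v x) - A (\<lambda>x. w x - v x) (\<lambda>x. w x - v x)) / 4"
    using assms
    by (simp add: stiffness.add_left stiffness.add_right stiffness.diff_left stiffness.diff_right
        stiffness.add_closed stiffness.diff_closed stiffness.commute[of w v])
  then show ?thesis
    using tau_pos by (simp add: leapfrog_energy_def modified_energy_def diff_divide_distrib)
qed

lemma modified_energy_le_leapfrog_energy:
  assumes "v \<in> V" "w \<in> V"
  shows "modified_energy v w \<le> leapfrog_energy v w"
  using leapfrog_energy_eq_modified_energy[OF assms]
    stiffness_nonneg[OF stiffness.diff_closed[OF assms(2,1)]] by simp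

lemma increment_le_modified_energy:
  assumes "v \<in> V" "w \<in> V"
  shows "\<mu> * B (\<lambda>x. w x - v x) (\<lambda>x. w x - v x) \<le> \<tau>\<^sup>2 * modified_energy v w"
  using coercive[OF stiffness.diff_closed[OF assms(2,1)]]
    stiffness_nonneg[OF stiffness.add_closed[OF assms(2,1)]] tau_pos
  by (simp add: modified_energy_def distrib_left add_increasing2)

lemma modified_energy_nonneg:
  assumes "v \<in> V" "w \<in> V"
  shows "0 \<le> modified_energy v w"
proof -
  have "0 \<le> \<mu> * B (\<lambda>x. w x - v x) (\<lambda>x. w x - v x)"
    using mass_nonneg[OF mass.diff_closed[OF assms(2,1)]] mu_pos by simp
  also have "\<dots> \<le> \<tau>\<^sup>2 * modified_energy v w"
    by (rule increment_le_modified_energy[OF assms])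
  finally show ?thesis
    using tau_pos by (simp add: zero_le_mult_iff)
qed

lemma leapfrog_energy_nonneg:
  assumes "v \<in> V" "w \<in> V"
  shows "0 \<le> leapfrog_energy v w"
  using modified_energy_nonneg[OF assms] modified_energy_le_leapfrog_energy[OF assms] by simp

lemma sqrt_increment_le:
  assumes "v \<in> V" "w \<in> V"
  shows "sqrt (B (\<lambda>x. w x - v x) (\<lambda>x. w x - v x)) \<le> \<tau> / sqrt \<mu> * sqrt (leapfrog_energy v w)"
proof -
  have "B (\<lambda>x. w x - v x) (\<lambda>x. w x - v x) \<le> \<tau>\<^sup>2 / \<mu> * leapfrog_energy v w"
  proof -
    have "\<mu> * B (\<lambda>x. w x - v x) (\<lambda>x. w x - v x) \<le> \<tau>\<^sup>2 * modified_energy v w"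
      by (rule increment_le_modified_energy[OF assms])
    also have "\<dots> \<le> \<tau>\<^sup>2 * leapfrog_energy v w"
      using modified_energy_le_leapfrog_energy[OF assms] by (simp add: mult_left_mono)
    finally show ?thesis
      using mu_pos by (simp add: field_simps)
  qed
  then have "sqrt (B (\<lambda>x. w x - v x) (\<lambda>x. w x - v x)) \<le> sqrt (\<tau>\<^sup>2 / \<mu> * leapfrog_energy v w)"
    by simp
  also have "\<dots> = \<tau> / sqrt \<mu> * sqrt (leapfrog_energy v w)"
    using tau_pos by (simp add: real_sqrt_mult real_sqrt_divide)
  finally show ?thesis .
qed

text \<open>The increments \<open>d = w - v\<close> and \<open>e = z - w\<close> turn the second difference into \<open>e - d\<close> and the test
  function into \<open>e + d\<close>, so the mass term is a difference of squares; the stiffness term telescopes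
  because \<open>A\<close> is symmetric.\<close>
lemma leapfrog_energy_step:
  assumes V: "v \<in> V" "w \<in> V" "z \<in> V"
    and eq: "1 / \<tau>\<^sup>2 * B (\<lambda>x. z x - 2 * w x + v x) (\<lambda>x. z x - v x) + A w (\<lambda>x. z x - v x) = r"
  shows "leapfrog_energy w z - leapfrog_energy v w = r"
proof -
  define d e where "d = (\<lambda>x. w x - v x)" and "e = (\<lambda>x. z x - w x)"
  have de: "d \<in> V" "e \<in> V"
    using V by (auto simp: d_def e_def intro: mass.diff_closed)
  have "(\<lambda>x. z x - 2 * w x + v x) = (\<lambda>x. e x - d x)" "(\<lambda>x. z x - v x) = (\<lambda>x. e x + d x)"
    by (auto simp: d_def e_def)
  then have "B (\<lambda>x. z x - 2 * w x + v x) (\<lambda>x. z x - v x) = B (\<lambda>x. e x - d x) (\<lambda>x. e x + d x)"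
    by metis
  also have "\<dots> = B e e - B d d"
    using de mass.commute[of d e]
    by (simp add: mass.diff_left mass.add_right mass.add_closed)
  finally have "B (\<lambda>x. z x - 2 * w x + v x) (\<lambda>x. z x - v x) = B e e - B d d" .
  moreover have "A w (\<lambda>x. z x - v x) = A w z - A v w"
    using V by (simp add: stiffness.diff_right stiffness.commute[of w v])
  ultimately show ?thesis
    using eq by (simp add: leapfrog_energy_def d_def e_def diff_divide_distrib)
qed

text \<open>The load is tested with two consecutive increments, each bounded by the root of its energy. The
  factor \<open>b + a\<close> therefore appears on both sides of the energy identity \<open>b\<^sup>2 - a\<^sup>2 = r\<close> and cancels.\<close>
lemma sqrt_leapfrog_energy_step:
  assumes V: "v \<in> V" "w \<in> V" "z \<in> V"
    and eq: "1 / \<tau>\<^sup>2 * B (\<lambda>x. z x - 2 * w x + v x) (\<lambda>x. z x - v x) + A w (\<lambda>x. z x - v x) = r"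
    and r: "r \<le> g * (sqrt (B (\<lambda>x. z x - w x) (\<lambda>x. z x - w x))
      + sqrt (B (\<lambda>x. w x - v x) (\<lambda>x. w x - v x)))"
    and g: "0 \<le> g"
  shows "sqrt (leapfrog_energy w z) \<le> sqrt (leapfrog_energy v w) + \<tau> / sqrt \<mu> * g"
proof -
  define a b c where "a = sqrt (leapfrog_energy v w)" and "b = sqrt (leapfrog_energy w z)"
    and "c = \<tau> / sqrt \<mu> * g"
  have nonneg: "0 \<le> a" "0 \<le> b" "0 \<le> c"
    using leapfrog_energy_nonneg V tau_pos mu_pos g by (auto simp: a_def b_def c_def)
  have "b\<^sup>2 - a\<^sup>2 = r"
    using leapfrog_energy_step[OF V eq] leapfrog_energy_nonneg V by (simp add: a_def b_def)
  also note r
  also have "g * (sqrt (B (\<lambda>x. z x - w x) (\<lambda>x. z x - w x))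
      + sqrt (B (\<lambda>x. w x - v x) (\<lambda>x. w x - v x))) \<le> g * (\<tau> / sqrt \<mu> * b + \<tau> / sqrt \<mu> * a)"
    unfolding a_def b_def using V g by (intro mult_left_mono add_mono sqrt_increment_le)
  also have "\<dots> = c * (b + a)"
    using mu_pos by (simp add: c_def field_simps)
  finally have "(b - a) * (b + a) \<le> c * (b + a)"
    by (simp add: power2_eq_square algebra_simps)
  then have "b \<le> a + c"
    using nonneg by (cases "b + a = 0") (auto simp: mult_le_cancel_right)
  then show ?thesis
    by (simp add: a_def b_def c_def)
qed

end

section \<open>Exponentially weighted sums\<close>

text \<open>Convexity of the square at the points \<open>x / q\<close> and \<open>y / (1 - q)\<close> with weights \<open>q\<close> and \<open>1 - q\<close>.\<close>
lemma square_sum_le_weighted: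
  fixes q x y :: real
  assumes "0 < q" "q < 1"
  shows "(x + y)\<^sup>2 \<le> x\<^sup>2 / q + y\<^sup>2 / (1 - q)"
proof -
  have "x\<^sup>2 / q + y\<^sup>2 / (1 - q) - (x + y)\<^sup>2 = ((1 - q) * x - q * y)\<^sup>2 / (q * (1 - q))"
    using assms by (simp add: field_simps power2_eq_square)
  also have "\<dots> \<ge> 0"
    using assms by simp
  finally show ?thesis
    by simp
qed

text \<open>This is Young's inequality for the convolution with the sequence \<open>q\<^sup>n\<close>, whose sum is
  \<open>1 / (1 - q)\<close>. A telescoping argument replaces the convolution: the induction carries the last
  weighted term along, which the next step consumes.\<close>
lemma weighted_square_sum_le:
  fixes s b :: "nat \<Rightarrow> real"
  assumes q: "0 < q" "q < 1" and s: "s 0 = 0" "\<And>n. 0 \<le> s n" and step: "\<And>n. s (Suc n) \<le> s n + b n"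
  shows "(\<Sum>n<N. (q ^ n * s (Suc n))\<^sup>2) \<le> (\<Sum>n<N. (q ^ n * b n)\<^sup>2) / (1 - q)\<^sup>2"
proof -
  have "(1 - q) * (\<Sum>n<N. (q ^ n * s (Suc n))\<^sup>2) + (q ^ N * s N)\<^sup>2 / q
      \<le> (\<Sum>n<N. (q ^ n * b n)\<^sup>2) / (1 - q)"
  proof (induction N)
    case 0
    then show ?case
      using s(1) by simp
  next
    case (Suc N)
    define x y u where "x = q ^ N * s N" and "y = q ^ N * b N" and "u = q ^ N * s (Suc N)"
    have "0 \<le> u"
      using q s(2) by (simp add: u_def)
    moreover have "u \<le> x + y"
      using step[of N] q by (simp add: x_def y_def u_def distrib_left[symmetric])
    ultimately have "u\<^sup>2 \<le> (x + y)\<^sup>2"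
      by (rule power_mono[rotated])
    also have "\<dots> \<le> x\<^sup>2 / q + y\<^sup>2 / (1 - q)"
      by (rule square_sum_le_weighted[OF q])
    finally have u: "u\<^sup>2 \<le> x\<^sup>2 / q + y\<^sup>2 / (1 - q)" .
    have "(q ^ Suc N * s (Suc N))\<^sup>2 / q = q * u\<^sup>2"
      using q by (simp add: u_def power2_eq_square)
    then have "(1 - q) * (\<Sum>n<Suc N. (q ^ n * s (Suc n))\<^sup>2) + (q ^ Suc N * s (Suc N))\<^sup>2 / q
        = (1 - q) * (\<Sum>n<N. (q ^ n * s (Suc n))\<^sup>2) + u\<^sup>2"
      by (simp add: u_def[symmetric] distrib_left) (simp add: left_diff_distrib)
    also have "\<dots> \<le> (1 - q) * (\<Sum>n<N. (q ^ n * s (Suc n))\<^sup>2) + x\<^sup>2 / q + y\<^sup>2 / (1 - q)"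
      using u by simp
    also have "\<dots> \<le> (\<Sum>n<Suc N. (q ^ n * b n)\<^sup>2) / (1 - q)"
      using Suc.IH by (simp add: x_def y_def add_divide_distrib)
    finally show ?case .
  qed
  moreover have "0 \<le> (q ^ N * s N)\<^sup>2 / q"
    using q by simp
  ultimately have "(1 - q) * (\<Sum>n<N. (q ^ n * s (Suc n))\<^sup>2) \<le> (\<Sum>n<N. (q ^ n * b n)\<^sup>2) / (1 - q)"
    by linarith
  moreover have "A \<le> B / r\<^sup>2" if "0 < r" "r * A \<le> B / r" for A B r :: real
    using that by (simp add: pos_le_divide_eq power2_eq_square mult_ac)
  ultimately show ?thesis
    using q by simp
qed

lemma one_minus_exp_lower_bound:
  fixes \<theta> :: real
  assumes "0 \<le> \<theta>"
  shows "\<theta> - \<theta>\<^sup>2 / 2 \<le> 1 - exp (- \<theta>)"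
proof -
  let ?f = "\<lambda>t::real. t\<^sup>2 / 2 - t + 1 - exp (- t)"
  have "?f 0 \<le> ?f \<theta>"
  proof (rule DERIV_nonneg_imp_nondecreasing[OF assms])
    fix t :: real
    have "(?f has_real_derivative t - 1 + exp (- t)) (at t)"
      by (auto intro!: derivative_eq_intros)
    moreover have "0 \<le> t - 1 + exp (- t)"
      using exp_ge_add_one_self[of "- t"] by simp
    ultimately show "\<exists>y. (?f has_real_derivative y) (at t) \<and> 0 \<le> y"
      by blast
  qed
  then show ?thesis
    by simp
qed

text \<open>One factor \<open>\<theta> / (1 - exp (- \<theta>))\<close> is part of \<open>C_X \<theta>\<close>. The other one is at most
  \<open>169 / (12 (13 - 6 \<theta>))\<close>: by the quadratic Taylor bound it suffices that
  \<open>12 (13 - 6 \<theta>) \<le> 169 (1 - \<theta> / 2)\<close>, that is, \<open>\<theta> \<le> 26 / 25\<close>.\<close>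
lemma square_le_C_X:
  assumes \<theta>: "0 < \<theta>" "\<theta> \<le> 1"
  shows "(\<theta> / (1 - exp (- \<theta>)))\<^sup>2 \<le> C_X \<theta>"
proof -
  have pos: "0 < 1 - exp (- \<theta>)" "0 < 13 - 6 * \<theta>"
    using \<theta> by auto
  have "12 * (13 - 6 * \<theta>) * \<theta> \<le> 169 * (1 - \<theta> / 2) * \<theta>"
    using \<theta> by (intro mult_right_mono) auto
  also have "\<dots> = 169 * (\<theta> - \<theta>\<^sup>2 / 2)"
    by (simp add: power2_eq_square algebra_simps)
  also have "\<dots> \<le> 169 * (1 - exp (- \<theta>))"
    using one_minus_exp_lower_bound[of \<theta>] \<theta> by simp
  finally have "\<theta> / (1 - exp (- \<theta>)) \<le> 169 / 12 * inverse (13 - 6 * \<theta>)"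
    using pos by (simp add: field_simps)
  then have "\<theta> / (1 - exp (- \<theta>)) * (\<theta> / (1 - exp (- \<theta>)))
      \<le> 169 / 12 * inverse (13 - 6 * \<theta>) * (\<theta> / (1 - exp (- \<theta>)))"
    using pos \<theta> by (intro mult_right_mono) auto
  then show ?thesis
    by (simp only: C_X_def power2_eq_square divide_inverse mult.assoc)
qed

lemma suminf_ennreal_le_cmult:
  fixes f g :: "nat \<Rightarrow> real"
  assumes g: "\<And>n. 0 \<le> g n" and f: "\<And>n. 0 \<le> f n" and c: "0 \<le> c"
    and le: "\<And>N. (\<Sum>n<N. f n) \<le> c * (\<Sum>n<N. g n)"
  shows "(\<Sum>n. ennreal (f n)) \<le> ennreal c * (\<Sum>n. ennreal (g n))"
proof (rule suminf_le_const)
  fix N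
  have "(\<Sum>n<N. ennreal (f n)) = ennreal (\<Sum>n<N. f n)"
    using f by (simp add: sum_ennreal)
  also have "\<dots> \<le> ennreal (c * (\<Sum>n<N. g n))"
    by (rule ennreal_leI[OF le])
  also have "\<dots> = ennreal c * (\<Sum>n<N. ennreal (g n))"
    using g c by (simp add: ennreal_mult sum_nonneg sum_ennreal)
  also have "\<dots> \<le> ennreal c * (\<Sum>n. ennreal (g n))"
    by (intro mult_left_mono sum_le_suminf) auto
  finally show "(\<Sum>n<N. ennreal (f n)) \<le> ennreal c * (\<Sum>n. ennreal (g n))" .
qed simp

section \<open>The stability estimate\<close>

lemma l2_inner_cong:
  assumes "\<And>x. x \<in> \<Omega> \<Longrightarrow> f x = f' x" "\<And>x. x \<in> \<Omega> \<Longrightarrow> g x = g' x"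
  shows "l2_inner \<Omega> f g = l2_inner \<Omega> f' g'"
  unfolding l2_inner_def set_lebesgue_integral_def
  using assms by (intro Bochner_Integration.integral_cong) (auto simp: indicator_def)

lemma V_h_mass_form:
  assumes "open \<Omega>" "bounded \<Omega>"
  shows "symmetric_form_on (V_h \<Omega> \<T> k) (l2_inner \<Omega>)"
proof
  fix a b :: real and u v w :: "'a \<Rightarrow> real"
  assume "u \<in> V_h \<Omega> \<T> k" "v \<in> V_h \<Omega> \<T> k" "w \<in> V_h \<Omega> \<T> k"
  then show "l2_inner \<Omega> u (\<lambda>x. a * v x + b * w x) = a * l2_inner \<Omega> u v + b * l2_inner \<Omega> u w"
    using l2_inner_lincomb_right[of u \<Omega> v w a b] V_h_subset_L2[OF assms] by simp
qed (auto intro: V_h_lincomb l2_inner_commute)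

lemma V_h_stiffness_form:
  assumes \<Omega>: "open \<Omega>" "bounded \<Omega>" and mesh: "simplicial_mesh \<Omega> \<T>"
  shows "symmetric_form_on (V_h \<Omega> \<T> k) (\<lambda>v w. l2_inner \<Omega> (grad v) (grad w))"
proof
  fix a b :: real and u v w :: "'a \<Rightarrow> real"
  assume uvw: "u \<in> V_h \<Omega> \<T> k" "v \<in> V_h \<Omega> \<T> k" "w \<in> V_h \<Omega> \<T> k"
  note grad_L2 = grad_V_h_in_L2[OF \<Omega> mesh]
  have "l2_inner \<Omega> (grad u) (grad (\<lambda>x. a * v x + b * w x)) =
      l2_inner \<Omega> (grad u) (\<lambda>x. a *\<^sub>R grad v x + b *\<^sub>R grad w x)"
    by (intro l2_inner_cong_AE L2_fun_lincomb grad_L2[OF uvw(1)] grad_L2[OF uvw(2)]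
        grad_L2[OF uvw(3)] grad_L2[OF V_h_lincomb[OF uvw(2,3)]] grad_lincomb_AE[OF mesh uvw(2,3)])
  also have "\<dots> = a * l2_inner \<Omega> (grad u) (grad v) + b * l2_inner \<Omega> (grad u) (grad w)"
    by (rule l2_inner_lincomb_right[OF uvw[THEN grad_L2]])
  finally show "l2_inner \<Omega> (grad u) (grad (\<lambda>x. a * v x + b * w x)) =
      a * l2_inner \<Omega> (grad u) (grad v) + b * l2_inner \<Omega> (grad u) (grad w)" .
qed (auto intro: V_h_lincomb l2_inner_commute)

lemma V_h_wave_forms:
  assumes \<Omega>: "open \<Omega>" "bounded \<Omega>" and mesh: "simplicial_mesh \<Omega> \<T>"
    and "0 < \<tau>" "0 < \<mu>" and cfl: "cfl_constant \<Omega> \<T> k \<mu> C" "\<tau> \<le> C * h_min \<T>"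
  shows "wave_forms (V_h \<Omega> \<T> k) (l2_inner \<Omega>) (\<lambda>v w. l2_inner \<Omega> (grad v) (grad w)) \<tau> \<mu>"
proof (intro wave_forms.intro wave_forms_axioms.intro V_h_mass_form V_h_stiffness_form
    \<Omega> mesh \<open>0 < \<tau>\<close> \<open>0 < \<mu>\<close> l2_inner_self_nonneg)
  fix v assume "v \<in> V_h \<Omega> \<T> k"
  then have "\<mu> * (l2_norm \<Omega> v)\<^sup>2 \<le> m_form \<Omega> \<tau> v v"
    using cfl \<open>0 < \<tau>\<close> unfolding cfl_constant_def by blast
  then show "\<mu> * l2_inner \<Omega> v v \<le> l2_inner \<Omega> v v - \<tau>\<^sup>2 * l2_inner \<Omega> (grad v) (grad v)"
    by (simp add: m_form_def l2_norm_power2)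
qed

theorem lemma7p1:
  fixes \<Omega> :: "'a::euclidean_space set"
    and \<T> :: "'a set set"
    and k :: nat
    and \<mu>\<^sub>0 C \<tau> \<rho> :: real
    and G :: "nat \<Rightarrow> 'a \<Rightarrow> real"
    and X :: "int \<Rightarrow> 'a \<Rightarrow> real"
  assumes "open \<Omega>" "bounded \<Omega>" "lipschitz_polyhedron \<Omega>"
    and "simplicial_mesh \<Omega> \<T>"
    and "1 \<le> k"
    and "0 < \<tau>"
    and "0 < \<mu>\<^sub>0" "\<mu>\<^sub>0 < 1"
    and "cfl_constant \<Omega> \<T> k \<mu>\<^sub>0 C" "\<tau> \<le> C * h_min \<T>"
    and "\<And>n. G n \<in> L2_fun \<Omega>"
    and "\<And>n::nat. X (int n) \<in> V_h \<Omega> \<T> k"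
    and "\<forall>x\<in>\<Omega>. X 0 x = 0" "\<forall>x\<in>\<Omega>. X (-1) x = 0"
    and "\<And>(n::nat) v. v \<in> V_h \<Omega> \<T> k \<Longrightarrow>
           1 / \<tau>\<^sup>2 * l2_inner \<Omega> (\<lambda>x. X (int n + 1) x - 2 * X (int n) x + X (int n - 1) x) v
             + l2_inner \<Omega> (grad (X (int n))) (grad v) = l2_inner \<Omega> (G n) v"
    and "0 < \<rho>" "\<rho> * \<tau> \<le> 1"
  shows "(\<Sum>n. ennreal (\<tau> * energy \<Omega> \<tau> X (int n) * exp (- 2 * \<rho> * (real n * \<tau>))))
           \<le> ennreal (C_X (\<rho> * \<tau>) * inverse \<mu>\<^sub>0 * (1 / \<rho>\<^sup>2)) *
             (\<Sum>n. ennreal (\<tau> * (l2_norm \<Omega> (G n))\<^sup>2 * exp (- 2 * \<rho> * (real n * \<tau>))))"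
proof -
  let ?V = "V_h \<Omega> \<T> k"
  note open_\<Omega> = assms(1) and bounded_\<Omega> = assms(2) and mesh = assms(4) and \<tau> = assms(6)
    and \<mu> = assms(7) and G = assms(11) and X_in_V = assms(12) and scheme = assms(15)
    and \<rho> = assms(16,17)
  interpret wave_forms ?V "l2_inner \<Omega>" "\<lambda>v w. l2_inner \<Omega> (grad v) (grad w)" \<tau> \<mu>\<^sub>0
    by (rule V_h_wave_forms[OF open_\<Omega> bounded_\<Omega> mesh \<tau> \<mu> assms(9,10)])
  \<comment> \<open>Shifting the index makes the first step uniform with the others. The iterate \<open>X (-1)\<close> is only
    known to vanish on \<open>\<Omega>\<close>, so it is replaced by the zero function, which belongs to the space.\<close>
  define Z where "Z n = (if n = 0 then (\<lambda>x. 0) else X (int n - 1))" for n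
  have Z_Suc: "Z (Suc n) = X (int n)" for n
    by (simp add: Z_def)
  have Z_in_V: "Z n \<in> ?V" for n
    by (cases n) (simp_all add: Z_Suc X_in_V, simp add: Z_def zero_in_V_h)
  have Z_eq: "Z n x = X (int n - 1) x" if "x \<in> \<Omega>" for n x
    using assms(14) that by (simp add: Z_def)

  define s where "s n = sqrt (leapfrog_energy (Z n) (Z (Suc n)))" for n
  have s_nonneg: "0 \<le> s n" for n
    by (simp add: s_def leapfrog_energy_nonneg Z_in_V)
  have s_0: "s 0 = 0"
  proof -
    have "Z 0 = (\<lambda>x. 0)"
      by (simp add: Z_def)
    then have "grad (Z 0) = (\<lambda>x. 0)"
      by (auto intro: grad_eq GDERIV_const)
    then have "l2_inner \<Omega> (grad (Z 0)) (grad (Z (Suc 0))) = 0"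
      by (simp add: l2_inner_def)
    moreover have "l2_inner \<Omega> (\<lambda>x. Z (Suc 0) x - Z 0 x) (\<lambda>x. Z (Suc 0) x - Z 0 x) =
        l2_inner \<Omega> (\<lambda>x. 0::real) (\<lambda>x. 0)"
      using assms(13) by (intro l2_inner_cong) (auto simp: Z_def)
    moreover have "l2_inner \<Omega> (\<lambda>x. 0::real) (\<lambda>x. 0) = 0"
      by (simp add: l2_inner_def)
    ultimately show ?thesis
      by (simp add: s_def leapfrog_energy_def)
  qed
  have step: "s (Suc n) \<le> s n + \<tau> / sqrt \<mu>\<^sub>0 * l2_norm \<Omega> (G n)" for n
  proof -
    define u v w where "u = Z n" and "v = Z (Suc n)" and "w = Z (Suc (Suc n))"
    have uvw: "u \<in> ?V" "v \<in> ?V" "w \<in> ?V"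
      by (simp_all add: u_def v_def w_def Z_in_V)
    have L2: "(\<lambda>x. w x - v x) \<in> L2_fun \<Omega>" "(\<lambda>x. v x - u x) \<in> L2_fun \<Omega>"
      using uvw by (auto intro: mass.diff_closed V_h_subset_L2[OF open_\<Omega> bounded_\<Omega>])
    have "l2_inner \<Omega> (\<lambda>x. w x - 2 * v x + u x) (\<lambda>x. w x - u x) =
        l2_inner \<Omega> (\<lambda>x. X (int n + 1) x - 2 * X (int n) x + X (int n - 1) x) (\<lambda>x. w x - u x)"
      by (rule l2_inner_cong) (auto simp: u_def v_def w_def Z_Suc Z_eq add.commute)
    then have eq: "1 / \<tau>\<^sup>2 * l2_inner \<Omega> (\<lambda>x. w x - 2 * v x + u x) (\<lambda>x. w x - u x)
        + l2_inner \<Omega> (grad v) (grad (\<lambda>x. w x - u x)) = l2_inner \<Omega> (G n) (\<lambda>x. w x - u x)"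
      using scheme[OF mass.diff_closed[OF uvw(3,1)], of n] by (simp add: v_def Z_Suc)
    have "l2_inner \<Omega> (G n) (\<lambda>x. w x - u x) =
        l2_inner \<Omega> (G n) (\<lambda>x. w x - v x) + l2_inner \<Omega> (G n) (\<lambda>x. v x - u x)"
      using l2_inner_lincomb_right[OF G L2, of n 1 1] by simp
    also have "\<dots> \<le> l2_norm \<Omega> (G n) * l2_norm \<Omega> (\<lambda>x. w x - v x)
        + l2_norm \<Omega> (G n) * l2_norm \<Omega> (\<lambda>x. v x - u x)"
      by (intro add_mono l2_Cauchy_Schwarz G L2)
    finally have "l2_inner \<Omega> (G n) (\<lambda>x. w x - u x) \<le> l2_norm \<Omega> (G n) *
        (sqrt (l2_inner \<Omega> (\<lambda>x. w x - v x) (\<lambda>x. w x - v x))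
          + sqrt (l2_inner \<Omega> (\<lambda>x. v x - u x) (\<lambda>x. v x - u x)))"
      by (simp add: l2_norm_def[of \<Omega> "\<lambda>x. w x - v x"] l2_norm_def[of \<Omega> "\<lambda>x. v x - u x"]
          distrib_left)
    from sqrt_leapfrog_energy_step[OF uvw eq this l2_norm_nonneg] show ?thesis
      by (simp add: s_def u_def v_def w_def)
  qed

  have energy_eq: "energy \<Omega> \<tau> X (int n) = modified_energy (X (int n)) (X (int n + 1))" for n
  proof -
    let ?v = "X (int n)" and ?w = "X (int n + 1)"
    have vw: "?v \<in> ?V" "?w \<in> ?V"
      using X_in_V[of n] X_in_V[of "Suc n"] by (simp_all add: add.commute)
    show ?thesis
      unfolding energy_def m_form_def X_dot_def X_half_def l2_norm_power2 modified_energy_def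
        mass.scale_self[OF mass.diff_closed[OF vw(2,1)]]
        stiffness.scale_self[OF mass.diff_closed[OF vw(2,1)]]
        stiffness.scale_self[OF mass.add_closed[OF vw(2,1)]]
      by (simp add: diff_divide_distrib power_divide)
  qed
  have energy_nonneg: "0 \<le> energy \<Omega> \<tau> X (int n)" for n
    using modified_energy_nonneg[OF Z_in_V Z_in_V, of "Suc n" "Suc (Suc n)"]
    by (simp add: energy_eq Z_Suc add.commute)
  have energy_le: "energy \<Omega> \<tau> X (int n) \<le> (s (Suc n))\<^sup>2" for n
    using modified_energy_le_leapfrog_energy[OF Z_in_V Z_in_V, of "Suc n" "Suc (Suc n)"]
      leapfrog_energy_nonneg[OF Z_in_V Z_in_V, of "Suc n" "Suc (Suc n)"]
    by (simp add: energy_eq s_def Z_Suc add.commute)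

  define q where "q = exp (- (\<rho> * \<tau>))"
  have q: "0 < q" "q < 1"
    using \<rho> \<tau> by (simp_all add: q_def)
  have exp_eq: "exp (- 2 * \<rho> * (real n * \<tau>)) = (q ^ n)\<^sup>2" for n
    by (simp add: q_def exp_of_nat_mult[symmetric] power_mult[symmetric] mult_ac)
  let ?c = "C_X (\<rho> * \<tau>) * inverse \<mu>\<^sub>0 * (1 / \<rho>\<^sup>2)"
  have const: "\<tau>\<^sup>2 / (1 - q)\<^sup>2 / \<mu>\<^sub>0 \<le> ?c"
  proof -
    have "(\<rho> * \<tau> / (1 - q))\<^sup>2 \<le> C_X (\<rho> * \<tau>)"
      unfolding q_def using \<rho> \<tau> by (intro square_le_C_X) auto
    then have "\<tau>\<^sup>2 / (1 - q)\<^sup>2 \<le> C_X (\<rho> * \<tau>) * (1 / \<rho>\<^sup>2)"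
      using \<rho> by (simp add: power_divide power_mult_distrib pos_le_divide_eq mult.commute)
    then have "\<tau>\<^sup>2 / (1 - q)\<^sup>2 / \<mu>\<^sub>0 \<le> C_X (\<rho> * \<tau>) * (1 / \<rho>\<^sup>2) / \<mu>\<^sub>0"
      using \<mu> by (intro divide_right_mono) auto
    then show ?thesis
      by (simp only: divide_inverse mult_ac)
  qed
  have partial_sum: "(\<Sum>n<N. \<tau> * energy \<Omega> \<tau> X (int n) * exp (- 2 * \<rho> * (real n * \<tau>)))
      \<le> ?c * (\<Sum>n<N. \<tau> * (l2_norm \<Omega> (G n))\<^sup>2 * exp (- 2 * \<rho> * (real n * \<tau>)))" for N
  proof -
    let ?S = "\<Sum>n<N. \<tau> * (l2_norm \<Omega> (G n))\<^sup>2 * exp (- 2 * \<rho> * (real n * \<tau>))"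
    have "(\<Sum>n<N. \<tau> * energy \<Omega> \<tau> X (int n) * exp (- 2 * \<rho> * (real n * \<tau>)))
        \<le> (\<Sum>n<N. \<tau> * (q ^ n * s (Suc n))\<^sup>2)"
    proof (rule sum_mono)
      fix n
      have "\<tau> * energy \<Omega> \<tau> X (int n) * (q ^ n)\<^sup>2 \<le> \<tau> * (s (Suc n))\<^sup>2 * (q ^ n)\<^sup>2"
        using \<tau> by (intro mult_right_mono mult_left_mono energy_le) auto
      then show "\<tau> * energy \<Omega> \<tau> X (int n) * exp (- 2 * \<rho> * (real n * \<tau>))
          \<le> \<tau> * (q ^ n * s (Suc n))\<^sup>2"
        unfolding exp_eq by (simp only: power_mult_distrib mult_ac)
    qed
    also have "\<dots> \<le> \<tau> * ((\<Sum>n<N. (q ^ n * (\<tau> / sqrt \<mu>\<^sub>0 * l2_norm \<Omega> (G n)))\<^sup>2) / (1 - q)\<^sup>2)"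
      unfolding sum_distrib_left[symmetric] using \<tau>
      by (intro mult_left_mono weighted_square_sum_le q s_0 s_nonneg step) simp
    also have "\<dots> = \<tau>\<^sup>2 / (1 - q)\<^sup>2 / \<mu>\<^sub>0 * ?S"
      unfolding exp_eq using \<mu>
      by (simp add: sum_distrib_left sum_divide_distrib power_mult_distrib power_divide mult_ac)
    also have "\<dots> \<le> ?c * ?S"
      using const \<tau> by (intro mult_right_mono sum_nonneg) auto
    finally show ?thesis .
  qed
  have c_nonneg: "0 \<le> ?c"
    using const \<mu> by (meson divide_nonneg_pos order_trans zero_le_divide_iff zero_le_power2)
  show ?thesis
    using \<tau> c_nonneg
    by (intro suminf_ennreal_le_cmult partial_sum) (auto simp: energy_nonneg)
qed

end
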